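(* Let $a,b,c$ be nonzero real numbers and let $\epsilon_0,d,m,w$ be positive real numbers. Let $\nu_0,\nu_1,\nu_2,\theta_0,\theta_1,\theta_2$ be real constants with $$2a\nu_1\theta_1+2\epsilon_0\nu_2\theta_2+\nu_0=0,\qquad a\nu_1^2+\epsilon_0\nu_2^2\neq0,\qquad \nu_1^2+\nu_2^2-m(\nu_0+c\nu_2)^2\neq0,$$ and put $$K=\frac{m\nu_0+(mc-d)\nu_2}{\nu_1^2+\nu_2^2-m(\nu_0+c\nu_2)^2},\quad A=\frac{b-mw-wK\big(m\nu_0+(mc-d)\nu_2\big)}{2(a\nu_1^2+\epsilon_0\nu_2^2)},\quad B=\frac{a\theta_1^2+\epsilon_0\theta_2^2+\theta_0}{a\nu_1^2+\epsilon_0\nu_2^2}.$$ Suppose $A<0$ and $B>0$. Then for all real constants $\delta_0,\Phi_0$, with $\nu=\nu_1x+\nu_2y+\nu_0t$ and $\theta=\theta_1x+\theta_2y+\theta_0t$, the functions $$\psi=e^{i\theta}\sqrt{-\frac BA}\ \mathrm{sech}\big(\sqrt B(\nu+\delta_0)\big),\qquad \varphi=-\frac{K\sqrt B}{A}\tanh\big(\sqrt B(\nu+\delta_0)\big)+\Phi_0$$ are a solution (a line soliton) of the Benney--Roskes/Zakharov--Rubenchik system $$\begin{aligned} &i\psi_t+a\psi_{xx}+\epsilon_0\psi_{yy}=(b-wm)|\psi|^2\psi-w\,\psi\,\Big\{m\tfrac{\partial}{\partial t}+(mc-d)\tfrac{\partial}{\partial y}\Big\}\varphi,\\ &\varphi_{xx}+(1-mc^2)\varphi_{yy}-m\varphi_{tt}-2mc\,\varphi_{yt}=\Big\{m\tfrac{\partial}{\partial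 t}+(mc-d)\tfrac{\partial}{\partial y}\Big\}|\psi|^2 . \end{aligned}$$
   Context: Here $\psi$ is complex-valued and $\varphi$ real-valued, both functions of $(x,y,t)\in\mathbb R^3$; all objects are introduced in the claim. *)

theory Defs
  imports "HOL-Analysis.Analysis"
begin

definition partial_x :: "(real \<Rightarrow> real \<Rightarrow> real \<Rightarrow> 'a::real_normed_vector) \<Rightarrow> real \<Rightarrow> real \<Rightarrow> real \<Rightarrow> 'a" where
  "partial_x f x y t = vector_derivative (\<lambda>s. f s y t) (at x)"

definition partial_y :: "(real \<Rightarrow> real \<Rightarrow> real \<Rightarrow> 'a::real_normed_vector) \<Rightarrow> real \<Rightarrow> real \<Rightarrow> real \<Rightarrow> 'a" where
  "partial_y f x y t = vector_derivative (\<lambda>s. f x s t) (at y)"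

definition partial_t :: "(real \<Rightarrow> real \<Rightarrow> real \<Rightarrow> 'a::real_normed_vector) \<Rightarrow> real \<Rightarrow> real \<Rightarrow> real \<Rightarrow> 'a" where
  "partial_t f x y t = vector_derivative (\<lambda>s. f x y s) (at t)"

definition partially_differentiable :: "(real \<Rightarrow> real \<Rightarrow> real \<Rightarrow> 'a::real_normed_vector) \<Rightarrow> bool" where
  "partially_differentiable f \<longleftrightarrow>
     (\<forall>x y t. (\<lambda>s. f s y t) differentiable (at x) \<and>
              (\<lambda>s. f x s t) differentiable (at y) \<and>
              (\<lambda>s. f x y s) differentiable (at t))"

primrec C_k_on_R3 :: "nat \<Rightarrow> (real \<Rightarrow> real \<Rightarrow> real \<Rightarrow> 'a::real_normed_vector) \<Rightarrow> bool" where
  "C_k_on_R3 0 f \<longleftrightarrow> continuous_on UNIV (\<lambda>(x, y, t). f x y t)"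
| "C_k_on_R3 (Suc k) f \<longleftrightarrow>
     continuous_on UNIV (\<lambda>(x, y, t). f x y t) \<and> partially_differentiable f \<and>
     C_k_on_R3 k (partial_x f) \<and> C_k_on_R3 k (partial_y f) \<and> C_k_on_R3 k (partial_t f)"

definition sech :: "real \<Rightarrow> real" where
  "sech z = 1 / cosh z"

definition transport_op :: "real \<Rightarrow> real \<Rightarrow> real \<Rightarrow> (real \<Rightarrow> real \<Rightarrow> real \<Rightarrow> real) \<Rightarrow> real \<Rightarrow> real \<Rightarrow> real \<Rightarrow> real" where
  "transport_op c d m f x y t = m * partial_t f x y t + (m * c - d) * partial_y f x y t"

text \<open>Classical solutions on all of space-time. The regularity requirement makes every derivative
  in the equations a genuine one: \<^const>\<open>vector_derivative\<close> is unspecified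
  at points of non-differentiability.\<close>

definition BRZR_solution ::
  "real \<Rightarrow> real \<Rightarrow> real \<Rightarrow> real \<Rightarrow> real \<Rightarrow> real \<Rightarrow> real \<Rightarrow>
   (real \<Rightarrow> real \<Rightarrow> real \<Rightarrow> complex) \<Rightarrow> (real \<Rightarrow> real \<Rightarrow> real \<Rightarrow> real) \<Rightarrow> bool" where
  "BRZR_solution a b c \<epsilon>\<^sub>0 d m w \<psi> \<phi> \<longleftrightarrow>
     C_k_on_R3 2 \<psi> \<and> C_k_on_R3 2 \<phi> \<and>
     (\<forall>x y t.
        \<i> * partial_t \<psi> x y t
          + of_real a * partial_x (partial_x \<psi>) x y t
          + of_real \<epsilon>\<^sub>0 * partial_y (partial_y \<psi>) x y t
        = of_real ((b - w * m) * (cmod (\<psi> x y t))\<^sup>2) * \<psi> x y t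
          - of_real w * \<psi> x y t * of_real (transport_op c d m \<phi> x y t)) \<and>
     (\<forall>x y t.
        partial_x (partial_x \<phi>) x y t
          + (1 - m * c\<^sup>2) * partial_y (partial_y \<phi>) x y t
          - m * partial_t (partial_t \<phi>) x y t
          - 2 * m * c * partial_t (partial_y \<phi>) x y t
        = transport_op c d m (\<lambda>x y t. (cmod (\<psi> x y t))\<^sup>2) x y t)"

end

theory Submission
  imports Defs
begin

text \<open>Profiles transported along a phase \<open>\<nu>\<close> and modulated by \<open>exp (\<theta> \<kappa>)\<close> form a class that is closed
  under partial differentiation: a derivative only replaces the profile \<open>h\<close> by
  \<open>\<theta>\<^sub>j \<kappa> h + \<nu>\<^sub>j h'\<close>. Both \<open>\<psi>\<close> (with \<open>\<kappa> = \<i>\<close>) and \<open>\<phi>\<close> (with \<open>\<kappa> = 0\<close>) belong to it, so the system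
  becomes a pair of ordinary differential identities for the profiles. The first linear condition on the
  constants cancels the imaginary part of the Schroedinger equation, and its real part is
  \<open>sech'' = sech - 2 sech\<^sup>3\<close>; the wave equation is \<open>tanh' = sech\<^sup>2\<close>, differentiated once.\<close>

definition modulated_wave ::
  "'a::{real_normed_field,banach} \<Rightarrow> real \<Rightarrow> real \<Rightarrow> real \<Rightarrow> real \<Rightarrow> real \<Rightarrow> real \<Rightarrow> (real \<Rightarrow> 'a)
    \<Rightarrow> real \<Rightarrow> real \<Rightarrow> real \<Rightarrow> 'a" where
  "modulated_wave \<kappa> \<theta>\<^sub>1 \<theta>\<^sub>2 \<theta>\<^sub>0 \<nu>\<^sub>1 \<nu>\<^sub>2 \<nu>\<^sub>0 h x y t =
     exp ((\<theta>\<^sub>1 * x + \<theta>\<^sub>2 * y + \<theta>\<^sub>0 * t) *\<^sub>R \<kappa>) * h (\<nu>\<^sub>1 * x + \<nu>\<^sub>2 * y + \<nu>\<^sub>0 * t)"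

lemma has_vector_derivative_modulated:
  fixes h h' :: "real \<Rightarrow> 'a::{real_normed_field,banach}"
  assumes "\<And>z. (h has_vector_derivative h' z) (at z)"
  shows "((\<lambda>s. exp ((\<alpha> * s + p) *\<^sub>R \<kappa>) * h (\<beta> * s + q)) has_vector_derivative
           exp ((\<alpha> * s + p) *\<^sub>R \<kappa>) * ((\<alpha> *\<^sub>R \<kappa>) * h (\<beta> * s + q) + \<beta> *\<^sub>R h' (\<beta> * s + q))) (at s)"
proof -
  have "((\<lambda>s. \<beta> * s + q) has_vector_derivative \<beta>) (at s)"
    by (auto intro!: derivative_eq_intros simp flip: has_real_derivative_iff_has_vector_derivative)
  from vector_diff_chain_at[OF this assms]
  have h: "((\<lambda>s. h (\<beta> * s + q)) has_vector_derivative \<beta> *\<^sub>R h' (\<beta> * s + q)) (at s)"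
    by (simp add: o_def)
  have "((\<lambda>s. \<alpha> * s + p) has_vector_derivative \<alpha>) (at s)"
    by (auto intro!: derivative_eq_intros simp flip: has_real_derivative_iff_has_vector_derivative)
  from vector_diff_chain_at[OF this exp_scaleR_has_vector_derivative_right]
  have "((\<lambda>s. exp ((\<alpha> * s + p) *\<^sub>R \<kappa>)) has_vector_derivative
           \<alpha> *\<^sub>R (exp ((\<alpha> * s + p) *\<^sub>R \<kappa>) * \<kappa>)) (at s)"
    by (simp add: o_def)
  from has_vector_derivative_mult[OF this h] show ?thesis
    by (simp add: algebra_simps)
qed

context
  fixes \<kappa> :: "'a::{real_normed_field,banach}" and \<theta>\<^sub>1 \<theta>\<^sub>2 \<theta>\<^sub>0 \<nu>\<^sub>1 \<nu>\<^sub>2 \<nu>\<^sub>0 :: real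
begin

private abbreviation "W \<equiv> modulated_wave \<kappa> \<theta>\<^sub>1 \<theta>\<^sub>2 \<theta>\<^sub>0 \<nu>\<^sub>1 \<nu>\<^sub>2 \<nu>\<^sub>0"

lemma modulated_wave_has_partial_derivatives:
  assumes "\<And>z. (h has_vector_derivative h' z) (at z)"
  shows "((\<lambda>s. W h s y t) has_vector_derivative W (\<lambda>z. (\<theta>\<^sub>1 *\<^sub>R \<kappa>) * h z + \<nu>\<^sub>1 *\<^sub>R h' z) x y t) (at x)"
    and "((\<lambda>s. W h x s t) has_vector_derivative W (\<lambda>z. (\<theta>\<^sub>2 *\<^sub>R \<kappa>) * h z + \<nu>\<^sub>2 *\<^sub>R h' z) x y t) (at y)"
    and "((\<lambda>s. W h x y s) has_vector_derivative W (\<lambda>z. (\<theta>\<^sub>0 *\<^sub>R \<kappa>) * h z + \<nu>\<^sub>0 *\<^sub>R h' z) x y t) (at t)"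
  using has_vector_derivative_modulated[OF assms, of \<theta>\<^sub>1 "\<theta>\<^sub>2 * y + \<theta>\<^sub>0 * t" \<kappa> \<nu>\<^sub>1 "\<nu>\<^sub>2 * y + \<nu>\<^sub>0 * t" x]
    has_vector_derivative_modulated[OF assms, of \<theta>\<^sub>2 "\<theta>\<^sub>1 * x + \<theta>\<^sub>0 * t" \<kappa> \<nu>\<^sub>2 "\<nu>\<^sub>1 * x + \<nu>\<^sub>0 * t" y]
    has_vector_derivative_modulated[OF assms, of \<theta>\<^sub>0 "\<theta>\<^sub>1 * x + \<theta>\<^sub>2 * y" \<kappa> \<nu>\<^sub>0 "\<nu>\<^sub>1 * x + \<nu>\<^sub>2 * y" t]
  unfolding modulated_wave_def by (simp_all only: ac_simps)

text \<open>Equations between functions rather than values, so that they can rewrite inside iterated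
  partial derivatives.\<close>

lemma partial_modulated_wave:
  assumes "\<And>z. (h has_vector_derivative h' z) (at z)"
  shows "partial_x (W h) = W (\<lambda>z. (\<theta>\<^sub>1 *\<^sub>R \<kappa>) * h z + \<nu>\<^sub>1 *\<^sub>R h' z)"
    and "partial_y (W h) = W (\<lambda>z. (\<theta>\<^sub>2 *\<^sub>R \<kappa>) * h z + \<nu>\<^sub>2 *\<^sub>R h' z)"
    and "partial_t (W h) = W (\<lambda>z. (\<theta>\<^sub>0 *\<^sub>R \<kappa>) * h z + \<nu>\<^sub>0 *\<^sub>R h' z)"
  unfolding fun_eq_iff partial_x_def partial_y_def partial_t_def
  by (intro allI vector_derivative_at modulated_wave_has_partial_derivatives[OF assms])+

lemma partially_differentiable_modulated_wave:
  assumes "\<And>z. (h has_vector_derivative h' z) (at z)"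
  shows "partially_differentiable (W h)"
  unfolding partially_differentiable_def
  using modulated_wave_has_partial_derivatives[OF assms] differentiableI_vector by blast

lemma continuous_modulated_wave:
  assumes "continuous_on UNIV h"
  shows "continuous_on UNIV (\<lambda>(x, y, t). W h x y t)"
  unfolding modulated_wave_def case_prod_unfold
  by (intro continuous_intros continuous_on_compose2[OF assms]) auto

text \<open>\<open>H j\<close> plays the role of the j-th derivative of the profile
  \<open>H 0\<close>. The induction must generalise over \<open>H\<close>, since every partial
  derivative changes the profile and uses up one term of the sequence.\<close>

lemma C_k_modulated_wave:
  assumes "\<And>j z. j < k \<Longrightarrow> (H j has_vector_derivative H (Suc j) z) (at z)"
    and "continuous_on UNIV (H k)"
  shows "C_k_on_R3 k (W (H 0))"
  using assms
proof (induction k arbitrary: H)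
  case 0
  then show ?case by (simp add: continuous_modulated_wave)
next
  case (Suc k)
  have H: "\<And>z. (H 0 has_vector_derivative H (Suc 0) z) (at z)"
    using Suc.prems(1) by blast
  have cont: "continuous_on UNIV (H j)" if "j < Suc k" for j
    using Suc.prems(1)[OF that] by (meson continuous_at_imp_continuous_on has_vector_derivative_continuous)
  \<comment> \<open>Arbitrary coefficients treat all three partial derivatives at once. By
    linearity, combining each \<open>H j\<close> with its successor gives the derivative sequence of
    the new profile.\<close>
  have "C_k_on_R3 k (W (\<lambda>z. (\<alpha> *\<^sub>R \<kappa>) * H 0 z + \<beta> *\<^sub>R H (Suc 0) z))" for \<alpha> \<beta>
  proof (rule Suc.IH[of "\<lambda>j z. (\<alpha> *\<^sub>R \<kappa>) * H j z + \<beta> *\<^sub>R H (Suc j) z"])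
    show "((\<lambda>z. (\<alpha> *\<^sub>R \<kappa>) * H j z + \<beta> *\<^sub>R H (Suc j) z) has_vector_derivative
            (\<alpha> *\<^sub>R \<kappa>) * H (Suc j) z + \<beta> *\<^sub>R H (Suc (Suc j)) z) (at z)" if "j < k" for j z
      using that Suc.prems(1)
      by (intro has_vector_derivative_add has_vector_derivative_mult_right
          bounded_linear.has_vector_derivative[OF bounded_linear_scaleR_right])
        auto
    show "continuous_on UNIV (\<lambda>z. (\<alpha> *\<^sub>R \<kappa>) * H k z + \<beta> *\<^sub>R H (Suc k) z)"
      using cont Suc.prems(2) by (intro continuous_intros) auto
  qed
  then show ?case
    using cont[of 0] continuous_modulated_wave partially_differentiable_modulated_wave[OF H]
    by (simp add: partial_modulated_wave[OF H])
qed

lemma C_2_modulated_wave: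
  assumes "\<And>z. (h has_vector_derivative h' z) (at z)"
    and "\<And>z. (h' has_vector_derivative h'' z) (at z)"
    and "continuous_on UNIV h''"
  shows "C_k_on_R3 2 (W h)"
proof -
  \<comment> \<open>List indexing turns the three given functions into a sequence; only the indices
    0, 1, 2 matter.\<close>
  have "C_k_on_R3 2 (W ([h, h', h''] ! 0))"
    by (rule C_k_modulated_wave) (use assms in \<open>auto simp: less_2_cases_iff\<close>)
  then show ?thesis by simp
qed

text \<open>On profiles, a partial derivative acts as multiplication by \<alpha>\<kappa> plus
  \<beta> d/dz. \<open>D\<close> is the expanded product of two such operators, applied to
  \<open>h\<close>.\<close>

lemma second_partial_modulated_wave:
  assumes h: "\<And>z. (h has_vector_derivative h' z) (at z)"
    and h': "\<And>z. (h' has_vector_derivative h'' z) (at z)"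
  defines "D \<equiv> \<lambda>\<alpha> \<beta> \<alpha>' \<beta>' z. (\<alpha> * \<alpha>') *\<^sub>R (\<kappa>\<^sup>2 * h z) + (\<alpha> * \<beta>' + \<alpha>' * \<beta>) *\<^sub>R (\<kappa> * h' z) + (\<beta> * \<beta>') *\<^sub>R h'' z"
  shows "partial_x (partial_x (W h)) = W (D \<theta>\<^sub>1 \<nu>\<^sub>1 \<theta>\<^sub>1 \<nu>\<^sub>1)"
    and "partial_y (partial_y (W h)) = W (D \<theta>\<^sub>2 \<nu>\<^sub>2 \<theta>\<^sub>2 \<nu>\<^sub>2)"
    and "partial_t (partial_t (W h)) = W (D \<theta>\<^sub>0 \<nu>\<^sub>0 \<theta>\<^sub>0 \<nu>\<^sub>0)"
    and "partial_t (partial_y (W h)) = W (D \<theta>\<^sub>0 \<nu>\<^sub>0 \<theta>\<^sub>2 \<nu>\<^sub>2)"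
proof -
  have d: "((\<lambda>z. (\<alpha> *\<^sub>R \<kappa>) * h z + \<beta> *\<^sub>R h' z) has_vector_derivative
            (\<alpha> *\<^sub>R \<kappa>) * h' z + \<beta> *\<^sub>R h'' z) (at z)" for \<alpha> \<beta> z
    by (intro has_vector_derivative_add has_vector_derivative_mult_right
        bounded_linear.has_vector_derivative[OF bounded_linear_scaleR_right] h h')
  show "partial_x (partial_x (W h)) = W (D \<theta>\<^sub>1 \<nu>\<^sub>1 \<theta>\<^sub>1 \<nu>\<^sub>1)"
    and "partial_y (partial_y (W h)) = W (D \<theta>\<^sub>2 \<nu>\<^sub>2 \<theta>\<^sub>2 \<nu>\<^sub>2)"
    and "partial_t (partial_t (W h)) = W (D \<theta>\<^sub>0 \<nu>\<^sub>0 \<theta>\<^sub>0 \<nu>\<^sub>0)"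
    and "partial_t (partial_y (W h)) = W (D \<theta>\<^sub>0 \<nu>\<^sub>0 \<theta>\<^sub>2 \<nu>\<^sub>2)"
    unfolding partial_modulated_wave[OF h] partial_modulated_wave[OF d] D_def
    by (rule arg_cong[where f = W];
        simp add: fun_eq_iff scaleR_conv_of_real power2_eq_square algebra_simps)+
qed

end

lemma sech_square: "(sech z)\<^sup>2 = 1 - (tanh z)\<^sup>2"
proof -
  have "(cosh z)\<^sup>2 \<noteq> 0" by simp
  then show ?thesis
    using cosh_square_eq[of z] by (simp add: sech_def tanh_def power_divide divide_eq_eq diff_divide_eq_iff)
qed

lemma sech_has_real_derivative [derivative_intros]:
  assumes "(g has_real_derivative g') (at z within S)"
  shows "((\<lambda>z. sech (g z)) has_real_derivative - (sech (g z) * tanh (g z)) * g') (at z within S)"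
  unfolding sech_def
  by (auto intro!: derivative_eq_intros assms simp: tanh_def power2_eq_square)

lemma continuous_on_sech [continuous_intros]:
  "continuous_on S g \<Longrightarrow> continuous_on S (\<lambda>z. sech (g z))"
  unfolding sech_def by (intro continuous_intros) auto

theorem mainTheorem4:
  fixes a b c \<epsilon>\<^sub>0 d m w :: real
    and \<nu>\<^sub>0 \<nu>\<^sub>1 \<nu>\<^sub>2 \<theta>\<^sub>0 \<theta>\<^sub>1 \<theta>\<^sub>2 :: real
    and K A B \<delta>\<^sub>0 \<Phi>\<^sub>0 :: real
    and \<nu> \<theta> :: "real \<Rightarrow> real \<Rightarrow> real \<Rightarrow> real"
    and \<psi> :: "real \<Rightarrow> real \<Rightarrow> real \<Rightarrow> complex"
    and \<phi> :: "real \<Rightarrow> real \<Rightarrow> real \<Rightarrow> real"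
  assumes "a \<noteq> 0" and "b \<noteq> 0" and "c \<noteq> 0"
    and "\<epsilon>\<^sub>0 > 0" and "d > 0" and "m > 0" and "w > 0"
    and "2 * a * \<nu>\<^sub>1 * \<theta>\<^sub>1 + 2 * \<epsilon>\<^sub>0 * \<nu>\<^sub>2 * \<theta>\<^sub>2 + \<nu>\<^sub>0 = 0"
    and "a * \<nu>\<^sub>1\<^sup>2 + \<epsilon>\<^sub>0 * \<nu>\<^sub>2\<^sup>2 \<noteq> 0"
    and "\<nu>\<^sub>1\<^sup>2 + \<nu>\<^sub>2\<^sup>2 - m * (\<nu>\<^sub>0 + c * \<nu>\<^sub>2)\<^sup>2 \<noteq> 0"
    and "K = (m * \<nu>\<^sub>0 + (m * c - d) * \<nu>\<^sub>2) / (\<nu>\<^sub>1\<^sup>2 + \<nu>\<^sub>2\<^sup>2 - m * (\<nu>\<^sub>0 + c * \<nu>\<^sub>2)\<^sup>2)"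
    and "A = (b - m * w - w * K * (m * \<nu>\<^sub>0 + (m * c - d) * \<nu>\<^sub>2)) / (2 * (a * \<nu>\<^sub>1\<^sup>2 + \<epsilon>\<^sub>0 * \<nu>\<^sub>2\<^sup>2))"
    and "B = (a * \<theta>\<^sub>1\<^sup>2 + \<epsilon>\<^sub>0 * \<theta>\<^sub>2\<^sup>2 + \<theta>\<^sub>0) / (a * \<nu>\<^sub>1\<^sup>2 + \<epsilon>\<^sub>0 * \<nu>\<^sub>2\<^sup>2)"
    and "A < 0" and "B > 0"
    and "\<nu> = (\<lambda>x y t. \<nu>\<^sub>1 * x + \<nu>\<^sub>2 * y + \<nu>\<^sub>0 * t)"
    and "\<theta> = (\<lambda>x y t. \<theta>\<^sub>1 * x + \<theta>\<^sub>2 * y + \<theta>\<^sub>0 * t)"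
    and "\<psi> = (\<lambda>x y t. exp (\<i> * of_real (\<theta> x y t)) * of_real (sqrt (- (B / A)))
                      * of_real (sech (sqrt B * (\<nu> x y t + \<delta>\<^sub>0))))"
    and "\<phi> = (\<lambda>x y t. - (K * sqrt B / A) * tanh (sqrt B * (\<nu> x y t + \<delta>\<^sub>0)) + \<Phi>\<^sub>0)"
  shows "BRZR_solution a b c \<epsilon>\<^sub>0 d m w \<psi> \<phi>"
proof -
  \<comment> \<open>\<open>N\<close> will be the coefficient of the second profile derivative in the
    Schroedinger equation, and \<open>P\<close> is what the transport operator becomes on functions
    of the phase alone. \<open>r\<close> is the amplitude and \<open>k\<close> the inverse width of
    the soliton.\<close>
  define N where "N = a * \<nu>\<^sub>1\<^sup>2 + \<epsilon>\<^sub>0 * \<nu>\<^sub>2\<^sup>2"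
  define P where "P = m * \<nu>\<^sub>0 + (m * c - d) * \<nu>\<^sub>2"
  define r where "r = sqrt (- (B / A))"
  define k where "k = sqrt B"
  have N: "N \<noteq> 0" using assms(9) by (simp add: N_def)
  \<comment> \<open>The definitions of \<open>B\<close>, \<open>A\<close> and \<open>K\<close> are
    cleared of denominators here, ready for polynomial reasoning.\<close>
  have BN: "B * N = a * \<theta>\<^sub>1\<^sup>2 + \<epsilon>\<^sub>0 * \<theta>\<^sub>2\<^sup>2 + \<theta>\<^sub>0"
    using assms(13) N by (simp add: N_def)
  have AN: "2 * A * N = b - m * w - w * K * P"
    using N unfolding assms(12) N_def[symmetric] P_def[symmetric] by simp
  have KD: "K * (\<nu>\<^sub>1\<^sup>2 + \<nu>\<^sub>2\<^sup>2 - m * (\<nu>\<^sub>0 + c * \<nu>\<^sub>2)\<^sup>2) = P"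
    using assms(10,11) by (simp add: P_def)
  have "B / A < 0" using \<open>A < 0\<close> \<open>B > 0\<close> by (simp add: divide_neg_pos divide_less_0_iff)
  then have r2: "r\<^sup>2 = - (B / A)" by (simp add: r_def)
  then have r2A: "r\<^sup>2 * A = - B" using \<open>A < 0\<close> by simp
  have k2: "k\<^sup>2 = B" using \<open>B > 0\<close> by (simp add: k_def)
  \<comment> \<open>The slope factor of the tanh profile equals \<open>K\<close> times the squared
    amplitude of \<psi>; this is what couples the two fields.\<close>
  have rk: "- (K * k / A) * k = K * r\<^sup>2"
    unfolding r2 k2[symmetric] by (simp add: power2_eq_square)

  \<comment> \<open>The shift by \<open>\<delta>\<^sub>0\<close> is absorbed into the profile,
    because a modulated wave has a purely linear phase.\<close>
  define u where "u z = k * (z + \<delta>\<^sub>0)" for z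
  have u [derivative_intros]: "(u has_real_derivative k) (at z)" for z
    unfolding u_def by (auto intro!: derivative_eq_intros)
  have cu [continuous_intros]: "continuous_on UNIV u"
    unfolding u_def by (intro continuous_intros)

  define f where "f z = r * sech (u z)" for z
  define f' where "f' z = - (r * k) * (sech (u z) * tanh (u z))" for z
  define f'' where "f'' z = r * B * (sech (u z) - 2 * sech (u z) ^ 3)" for z
  have f: "(f has_real_derivative f' z) (at z)" for z
    unfolding f_def f'_def by (auto intro!: derivative_eq_intros)
  have f': "(f' has_real_derivative f'' z) (at z)" for z
  proof -
    have "(f' has_real_derivative - (r * k) *
        (sech (u z) * ((sech (u z))\<^sup>2 * k) + - (sech (u z) * tanh (u z)) * k * tanh (u z))) (at z)"
      unfolding f'_def
      by (auto intro!: derivative_eq_intros simp: sech_square algebra_simps)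
    \<comment> \<open>Eliminating tanh turns the product-rule expression into the cubic in sech that
      defines \<open>f''\<close>.\<close>
    moreover have "(tanh (u z))\<^sup>2 = 1 - (sech (u z))\<^sup>2" by (simp add: sech_square)
    then have "- (r * k) *
        (sech (u z) * ((sech (u z))\<^sup>2 * k) + - (sech (u z) * tanh (u z)) * k * tanh (u z)) = f'' z"
      unfolding f''_def k2[symmetric] by algebra
    ultimately show ?thesis by simp
  qed
  have cf'': "continuous_on UNIV f''"
    unfolding f''_def by (intro continuous_intros)

  define g where "g z = - (K * k / A) * tanh (u z) + \<Phi>\<^sub>0" for z
  \<comment> \<open>Here \<open>q\<close> is the profile of the squared modulus of \<psi>, and
    \<open>g'\<close> is \<open>K\<close> times \<open>q\<close>: the wave equation integrated once
    along the phase.\<close>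
  define g' where "g' z = K * r\<^sup>2 * (sech (u z))\<^sup>2" for z
  define q where "q z = r\<^sup>2 * (sech (u z))\<^sup>2" for z
  define q' where "q' z = - 2 * r\<^sup>2 * k * ((sech (u z))\<^sup>2 * tanh (u z))" for z
  have g: "(g has_real_derivative g' z) (at z)" for z
    using \<open>A < 0\<close> unfolding g_def g'_def rk[symmetric]
    by (auto intro!: derivative_eq_intros simp: sech_square)
  have q: "(q has_real_derivative q' z) (at z)" for z
    unfolding q_def q'_def
    by (auto intro!: derivative_eq_intros simp: power2_eq_square algebra_simps)
  have g': "(g' has_real_derivative K * q' z) (at z)" for z
    using DERIV_cmult[OF q, of K] by (simp add: g'_def[abs_def] q_def[abs_def] mult.assoc)
  have cq': "continuous_on UNIV (\<lambda>z. K * q' z)"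
    unfolding q'_def by (intro continuous_intros) auto

  let ?F = "\<lambda>z. complex_of_real (f z)" and ?F' = "\<lambda>z. complex_of_real (f' z)"
    and ?F'' = "\<lambda>z. complex_of_real (f'' z)"
  let ?W = "modulated_wave \<i> \<theta>\<^sub>1 \<theta>\<^sub>2 \<theta>\<^sub>0 \<nu>\<^sub>1 \<nu>\<^sub>2 \<nu>\<^sub>0"
  \<comment> \<open>With zero modulation the exponential is 1, leaving a pure travelling
    profile.\<close>
  let ?V = "modulated_wave (0::real) 0 0 0 \<nu>\<^sub>1 \<nu>\<^sub>2 \<nu>\<^sub>0"
  have F: "(?F has_vector_derivative ?F' z) (at z)" "(?F' has_vector_derivative ?F'' z) (at z)" for z
    using f f' by (auto intro!: has_vector_derivative_of_real)
  have cF'': "continuous_on UNIV ?F''"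
    using cf'' by (intro continuous_intros)
  note G = g[unfolded has_real_derivative_iff_has_vector_derivative]
    and G' = g'[unfolded has_real_derivative_iff_has_vector_derivative]
    and Q = q[unfolded has_real_derivative_iff_has_vector_derivative]
  have psi: "\<psi> = ?W ?F"
    unfolding assms(16-18) modulated_wave_def fun_eq_iff
    by (simp add: f_def u_def k_def r_def scaleR_conv_of_real mult.commute mult.left_commute)
  have phi: "\<phi> = ?V g"
    unfolding assms(16,19) modulated_wave_def fun_eq_iff
    by (simp add: g_def u_def k_def)
  have norm_exp: "cmod (exp (s *\<^sub>R \<i>)) = 1" for s
    by (simp add: scaleR_conv_of_real mult.commute)
  \<comment> \<open>The phase factor has modulus 1, so the squared modulus is again a travelling
    profile and \<open>transport\<close> will apply to it as well as to \<phi>.\<close>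
  have mod_psi: "(\<lambda>x y t. (cmod (\<psi> x y t))\<^sup>2) = ?V q"
    unfolding psi modulated_wave_def fun_eq_iff norm_mult norm_exp
    by (simp add: f_def q_def norm_mult power_mult_distrib)
  have transport: "transport_op c d m (?V h) x y t = P * h' (\<nu>\<^sub>1 * x + \<nu>\<^sub>2 * y + \<nu>\<^sub>0 * t)"
    if "\<And>z. (h has_vector_derivative h' z) (at z)" for h h' x y t
    unfolding transport_op_def partial_modulated_wave[OF that]
    by (simp add: modulated_wave_def P_def algebra_simps)

  have "C_k_on_R3 2 \<psi>" unfolding psi by (rule C_2_modulated_wave[OF F cF''])
  moreover have "C_k_on_R3 2 \<phi>" unfolding phi by (rule C_2_modulated_wave[OF G G' cq'])
  moreover have "\<i> * partial_t \<psi> x y t + of_real a * partial_x (partial_x \<psi>) x y t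
          + of_real \<epsilon>\<^sub>0 * partial_y (partial_y \<psi>) x y t
        = of_real ((b - w * m) * (cmod (\<psi> x y t))\<^sup>2) * \<psi> x y t
          - of_real w * \<psi> x y t * of_real (transport_op c d m \<phi> x y t)" (is "?L = ?R") for x y t
  proof -
    define z where "z = \<nu>\<^sub>1 * x + \<nu>\<^sub>2 * y + \<nu>\<^sub>0 * t"
    define E where "E = exp ((\<theta>\<^sub>1 * x + \<theta>\<^sub>2 * y + \<theta>\<^sub>0 * t) *\<^sub>R \<i>)"
    have W: "?W h x y t = E * h z" for h
      by (simp add: modulated_wave_def z_def E_def)
    have qz: "(cmod (\<psi> x y t))\<^sup>2 = q z"
      using fun_cong[OF fun_cong[OF fun_cong[OF mod_psi]], of x y t] by (simp add: modulated_wave_def z_def)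
    have "?R = E * of_real ((b - w * m) * q z * f z - w * f z * (P * g' z))"
      unfolding qz unfolding phi transport[OF G] psi W z_def[symmetric] by (simp add: algebra_simps)
    \<comment> \<open>Since \<open>g'\<close> is \<open>K\<close> times \<open>q\<close>, the
      mean-flow term is cubic too and merges with the self-interaction; the joint coefficient is
      \<open>2 * A * N\<close> by \<open>AN\<close>.\<close>
    also have "(b - w * m) * q z * f z - w * f z * (P * g' z) = (b - m * w - w * K * P) * r\<^sup>2 * (r * sech (u z) ^ 3)"
      unfolding q_def f_def g'_def by algebra
    also have "\<dots> = - 2 * B * N * (r * sech (u z) ^ 3)"
      unfolding AN[symmetric] using r2A by algebra
    \<comment> \<open>The profile equation for sech trades the cubic term for \<open>f''\<close> and
      \<open>f\<close>, making the right side linear in the profile.\<close>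
    also have "\<dots> = N * f'' z - B * N * f z"
      unfolding f''_def f_def by algebra
    finally have R: "?R = E * of_real (N * f'' z - B * N * f z)" .
    \<comment> \<open>Apart from \<open>E\<close>, this separates real and imaginary parts. The
      square of \<i> and the time derivative of the carrier give the \<open>f\<close> term; the
      cross terms and the motion of the envelope give the \<open>f'\<close> term, which
      \<open>assms(8)\<close> annihilates. \<open>BN\<close> then matches the rest.\<close>
    have "?L = E * (of_real (N * f'' z - (a * \<theta>\<^sub>1\<^sup>2 + \<epsilon>\<^sub>0 * \<theta>\<^sub>2\<^sup>2 + \<theta>\<^sub>0) * f z)
        + \<i> * of_real ((2 * a * \<nu>\<^sub>1 * \<theta>\<^sub>1 + 2 * \<epsilon>\<^sub>0 * \<nu>\<^sub>2 * \<theta>\<^sub>2 + \<nu>\<^sub>0) * f' z))"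
      unfolding psi second_partial_modulated_wave[OF F] unfolding partial_modulated_wave[OF F(1)] W N_def
      by (simp add: scaleR_conv_of_real algebra_simps power2_eq_square)
    then show ?thesis unfolding R assms(8) BN by simp
  qed
  moreover have "partial_x (partial_x \<phi>) x y t + (1 - m * c\<^sup>2) * partial_y (partial_y \<phi>) x y t
          - m * partial_t (partial_t \<phi>) x y t - 2 * m * c * partial_t (partial_y \<phi>) x y t
        = transport_op c d m (\<lambda>x y t. (cmod (\<psi> x y t))\<^sup>2) x y t" for x y t
    \<comment> \<open>On travelling profiles the wave operator multiplies the second derivative
      \<open>K * q'\<close> by \<open>\<nu>\<^sub>1\<^sup>2 + \<nu>\<^sub>2\<^sup>2 - m *
      (\<nu>\<^sub>0 + c * \<nu>\<^sub>2)\<^sup>2\<close>, after completing the square. By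
      \<open>KD\<close> the result is \<open>P * q'\<close>, the transported squared
      modulus.\<close>
    unfolding mod_psi transport[OF Q] phi second_partial_modulated_wave[OF G G'] KD[symmetric]
    by (simp add: modulated_wave_def power2_eq_square algebra_simps)
  ultimately show ?thesis unfolding BRZR_solution_def by blast
qed

end
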